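(* Consider the network model and the NSB algorithm described in the context, in the setting without packet arrivals (no exogenous arrivals after time 0). For every graph $G$ and every finite collection of initial packets, the evacuation time of NSB (under any tie-breaking rule) is at most $\frac{3}{2}$ times the minimum evacuation time. That is, NSB has an approximation ratio no greater than $3/2$ for the evacuation time.
   Context: Network model. $G=(V,E)$ is a finite undirected graph with $n=|V|$ nodes and $m=|E|$ links; $L(i)$ denotes the set of links incident to node $i$. Time is slotted, $k=0,1,2,\dots$. Each link $l$ has a queue; $Q_l(k)$ is the number of packets waiting at link $l$ in time-slot $k$ (including packets arriving in slot $k$), and the workload (queue length) of node $i$ is $Q_i(k)=\sum_{l\in L(i)}Q_l(k)$. A schedule in a slot is a matching of $G$ (a set of links no two of which share an endpoint; one-hop interference model); only links with $Q_l(k)>0$ may be scheduled; each scheduled link transmits exactly one packet, which then leaves the system (single-hop traffic, unit link capacities). NSB algorithm. Time-slots are grouped into frames: frame $k'$ consists of slots $3k',3k'+1,3k'+2$. Let $R_i(k)=1$ if node $i$ is an endpoint of a link scheduled in slot $k$ and $R_i(k)=0$ otherwise (with $R_i(k)=0$ for $k<0$). Define $U_i(k)=R_i(k-1)R_i(k-2)$ if $k=3k'+2$ for some integer $k'$, and $U_i(k)=R_i(k-1)$ otherwise. Let $\Delta(k)=\max_{i\in V}Q_i(k)$. Node $i$ is heavy in slot $k$ if $Q_i(k)\ge \frac{n-1}{n}\Delta(k)$. In each slot $k$, NSB assigns node weights $w_i(k)=Q_i(k)(2-U_i(k))$ if $i$ is heavy and $w_i(k)=Q_i(k)$ otherwise;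 it excludes links with $Q_l(k)=0$, and chooses, among matchings $M$ of the remaining links, one maximizing $w(M)=\sum_{i:\,M\cap L(i)\neq\emptyset}w_i(k)$ (a maximum vertex-weighted matching, ties broken arbitrarily); one packet is transmitted on each link of the chosen matching. Evacuation time. Given finitely many initial packets and no further arrivals, the evacuation time of a scheduling algorithm is the number of time-slots it needs to transmit all the initial packets; the minimum evacuation time $\mathcal{X}'$ is the minimum of this over all feasible scheduling algorithms. An algorithm has approximation ratio $\eta$ if its evacuation time is at most $\eta\,\mathcal{X}'$ for every network graph and every finite set of initial packets. *)

theory Defs
  imports Complex_Main
begin

definition graph :: "'v set \<Rightarrow> 'v set set \<Rightarrow> bool" where
  "graph V E \<longleftrightarrow> finite V \<and> (\<forall>e\<in>E. e \<subseteq> V \<and> card e = 2)"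

definition matching_of :: "'v set set \<Rightarrow> 'v set set \<Rightarrow> bool" where
  "matching_of L M \<longleftrightarrow> M \<subseteq> L \<and> (\<forall>e1\<in>M. \<forall>e2\<in>M. e1 \<noteq> e2 \<longrightarrow> e1 \<inter> e2 = {})"

text \<open>Queue lengths under a schedule S (S k = set of links scheduled in slot k),
  starting from the initial queues Q0, without arrivals.\<close>
fun queue :: "('v set \<Rightarrow> nat) \<Rightarrow> (nat \<Rightarrow> 'v set set) \<Rightarrow> nat \<Rightarrow> 'v set \<Rightarrow> nat" where
  "queue Q0 S 0 l = Q0 l"
| "queue Q0 S (Suc k) l = queue Q0 S k l - (if l \<in> S k then 1 else 0)"

definition feasible :: "'v set set \<Rightarrow> ('v set \<Rightarrow> nat) \<Rightarrow> (nat \<Rightarrow> 'v set set) \<Rightarrow> bool" where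
  "feasible E Q0 S \<longleftrightarrow>
     (\<forall>k. matching_of {l \<in> E. queue Q0 S k l > 0} (S k))"

definition evacuated :: "'v set set \<Rightarrow> ('v set \<Rightarrow> nat) \<Rightarrow> (nat \<Rightarrow> 'v set set) \<Rightarrow> nat \<Rightarrow> bool" where
  "evacuated E Q0 S T \<longleftrightarrow> (\<forall>l\<in>E. queue Q0 S T l = 0)"

definition evac_time :: "'v set set \<Rightarrow> ('v set \<Rightarrow> nat) \<Rightarrow> (nat \<Rightarrow> 'v set set) \<Rightarrow> nat" where
  "evac_time E Q0 S = (LEAST T. evacuated E Q0 S T)"

definition min_evac_time :: "'v set set \<Rightarrow> ('v set \<Rightarrow> nat) \<Rightarrow> nat" where
  "min_evac_time E Q0 = (LEAST T. \<exists>S. feasible E Q0 S \<and> evacuated E Q0 S T)"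

definition node_queue :: "'v set set \<Rightarrow> ('v set \<Rightarrow> nat) \<Rightarrow> (nat \<Rightarrow> 'v set set) \<Rightarrow> nat \<Rightarrow> 'v \<Rightarrow> nat" where
  "node_queue E Q0 S k i = (\<Sum>l\<in>{l\<in>E. i \<in> l}. queue Q0 S k l)"

definition R :: "(nat \<Rightarrow> 'v set set) \<Rightarrow> 'v \<Rightarrow> nat \<Rightarrow> nat" where
  "R S i k = (if i \<in> \<Union>(S k) then 1 else 0)"

text \<open>U_i(k), with R_i(k) = 0 for k < 0.\<close>
definition U :: "(nat \<Rightarrow> 'v set set) \<Rightarrow> 'v \<Rightarrow> nat \<Rightarrow> nat" where
  "U S i k = (if k mod 3 = 2 then R S i (k - 1) * R S i (k - 2)
              else if k = 0 then 0 else R S i (k - 1))"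

definition Delta :: "'v set \<Rightarrow> 'v set set \<Rightarrow> ('v set \<Rightarrow> nat) \<Rightarrow> (nat \<Rightarrow> 'v set set) \<Rightarrow> nat \<Rightarrow> nat" where
  "Delta V E Q0 S k = Max (node_queue E Q0 S k ` V)"

definition heavy :: "'v set \<Rightarrow> 'v set set \<Rightarrow> ('v set \<Rightarrow> nat) \<Rightarrow> (nat \<Rightarrow> 'v set set) \<Rightarrow> nat \<Rightarrow> 'v \<Rightarrow> bool" where
  "heavy V E Q0 S k i \<longleftrightarrow>
     real (node_queue E Q0 S k i) \<ge> (real (card V) - 1) / real (card V) * real (Delta V E Q0 S k)"

definition nsb_weight :: "'v set \<Rightarrow> 'v set set \<Rightarrow> ('v set \<Rightarrow> nat) \<Rightarrow> (nat \<Rightarrow> 'v set set) \<Rightarrow> nat \<Rightarrow> 'v \<Rightarrow> real" where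
  "nsb_weight V E Q0 S k i =
     (if heavy V E Q0 S k i
      then real (node_queue E Q0 S k i) * (2 - real (U S i k))
      else real (node_queue E Q0 S k i))"

definition matching_weight :: "'v set \<Rightarrow> 'v set set \<Rightarrow> ('v set \<Rightarrow> nat) \<Rightarrow> (nat \<Rightarrow> 'v set set) \<Rightarrow> nat \<Rightarrow> 'v set set \<Rightarrow> real" where
  "matching_weight V E Q0 S k M = (\<Sum>i\<in>{i\<in>V. i \<in> \<Union>M}. nsb_weight V E Q0 S k i)"

text \<open>S is a run of NSB (with some tie-breaking): in every slot it picks a
  maximum vertex-weighted matching of the links with nonempty queues.\<close>
definition nsb_run :: "'v set \<Rightarrow> 'v set set \<Rightarrow> ('v set \<Rightarrow> nat) \<Rightarrow> (nat \<Rightarrow> 'v set set) \<Rightarrow> bool" where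
  "nsb_run V E Q0 S \<longleftrightarrow>
     (\<forall>k. matching_of {l \<in> E. queue Q0 S k l > 0} (S k) \<and>
          (\<forall>M. matching_of {l \<in> E. queue Q0 S k l > 0} M \<longrightarrow>
               matching_weight V E Q0 S k M \<le> matching_weight V E Q0 S k (S k)))"

end

theory Submission
  imports Defs
begin

text \<open>With \<open>\<Delta>\<close> the largest workload, every schedule needs at least \<open>\<Delta>\<close> slots, so it suffices that
  each frame of NSB lowers \<open>\<Delta>\<close> by 2 (down to 0). Call a node critical if its workload is \<open>\<Delta>\<close>
  and \<open>U = 0\<close>. Critical nodes have weight \<open>2 * \<Delta>\<close> and all other nodes weigh less; hence, by
  exchange along alternating paths, NSB serves all of them whenever some matching covers them.
  Counting packets, Hall's theorem gives an injection of the critical nodes into their neighbours,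
  and if they induce a bipartite graph, this injection yields such a matching. Maximality of the
  chosen matchings makes the sets of unserved nodes independent, so the critical nodes of the
  second and third slot of a frame do induce bipartite graphs. Only nodes of workload exactly
  \<open>\<Delta>\<close> matter here, so the precise threshold for being heavy plays no role.\<close>

subsection \<open>Matchings\<close>

text \<open>Induction on \<open>card I\<close>, splitting on whether some proper nonempty subfamily
  is tight. A tight one is solved first, and the rest avoids its union. Without one there is slack
  of one element everywhere, so one index may receive any of its elements.\<close>

lemma hall_marriage:
  fixes A :: "'i \<Rightarrow> 'a set"
  assumes "finite I" "\<And>i. i \<in> I \<Longrightarrow> finite (A i)"
    and "\<And>J. J \<subseteq> I \<Longrightarrow> card J \<le> card (\<Union>(A ` J))"
  shows "\<exists>f. inj_on f I \<and> (\<forall>i\<in>I. f i \<in> A i)"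
  using assms
proof (induction "card I" arbitrary: I A rule: less_induct)
  case less
  note fin = less.prems(1) and finA = less.prems(2) and hall = less.prems(3)
  have finU: "finite (\<Union>(A ` J))" if "J \<subseteq> I" for J
    using that fin finA by (meson finite_UN_I finite_subset subsetD)
  show ?case
  proof (cases "\<exists>J. J \<subset> I \<and> J \<noteq> {} \<and> card (\<Union>(A ` J)) = card J")
    case True
    then obtain J where J: "J \<subset> I" "J \<noteq> {}" "card (\<Union>(A ` J)) = card J" by blast
    let ?B = "\<Union>(A ` J)"
    have finJ: "finite J" using J fin finite_subset by blast
    have "card J < card I" using J fin by (simp add: psubset_card_mono)
    then obtain f where f: "inj_on f J" "\<forall>i\<in>J. f i \<in> A i"
      using less.hyps[of J A] J finJ finA hall
      by (metis (full_types) dual_order.trans psubset_imp_subset subset_iff)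
    have "card (I - J) < card I"
      using J fin by (intro psubset_card_mono) auto
    \<comment> \<open>Hall's condition for \<open>K \<union> J\<close>; by tightness
      \<open>J\<close> uses up exactly \<open>card ?B\<close>.\<close>
    moreover have "card K \<le> card (\<Union>((\<lambda>i. A i - ?B) ` K))" if K: "K \<subseteq> I - J" for K
    proof -
      have KJ: "K \<union> J \<subseteq> I" using K J by auto
      have "card K + card J = card (K \<union> J)"
        using K finJ fin by (subst card_Un_disjoint) (auto dest: finite_subset)
      also have "\<dots> \<le> card (\<Union>(A ` (K \<union> J)))" by (rule hall[OF KJ])
      also have "\<Union>(A ` (K \<union> J)) = \<Union>((\<lambda>i. A i - ?B) ` K) \<union> ?B" by auto
      also have "card \<dots> \<le> card (\<Union>((\<lambda>i. A i - ?B) ` K)) + card ?B"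
        by (rule card_Un_le)
      finally show ?thesis using J(3) by simp
    qed
    ultimately obtain g where g: "inj_on g (I - J)" "\<forall>i\<in>I - J. g i \<in> A i - ?B"
      using less.hyps[of "I - J" "\<lambda>i. A i - ?B"] fin finA by auto
    let ?h = "\<lambda>i. if i \<in> J then f i else g i"
    have "inj_on ?h I"
    proof (rule inj_onI)
      fix x y assume xy: "x \<in> I" "y \<in> I" "?h x = ?h y"
      have "?h z \<in> ?B \<longleftrightarrow> z \<in> J" if "z \<in> I" for z
        using f(2) g(2) that by (cases "z \<in> J") auto
      from this[OF xy(1)] this[OF xy(2)] have "x \<in> J \<longleftrightarrow> y \<in> J" using xy(3) by metis
      then show "x = y"
        using xy inj_onD[OF f(1), of x y] inj_onD[OF g(1), of x y] by (cases "x \<in> J") auto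
    qed
    moreover have "\<forall>i\<in>I. ?h i \<in> A i" using f(2) g(2) by auto
    ultimately show ?thesis by (intro exI[of _ ?h] conjI)
  next
    case False
    show ?thesis
    proof (cases "I = {}")
      case True
      then show ?thesis by simp
    next
      case False
      then obtain i where i: "i \<in> I" by blast
      have "card {i} \<le> card (\<Union>(A ` {i}))" by (rule hall) (use i in auto)
      then obtain a where a: "a \<in> A i" by fastforce
      have "card (I - {i}) < card I" using i fin by (meson card_Diff1_less)
      moreover have "card K \<le> card (\<Union>((\<lambda>i. A i - {a}) ` K))" if K: "K \<subseteq> I - {i}" for K
      proof (cases "K = {}")
        case False
        have KI: "K \<subset> I" using K i by auto
        then have "card K \<noteq> card (\<Union>(A ` K))"
          using \<open>\<not> (\<exists>J. J \<subset> I \<and> J \<noteq> {} \<and> card (\<Union>(A ` J)) = card J)\<close> False by metis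
        moreover have "card K \<le> card (\<Union>(A ` K))" using KI by (intro hall) auto
        moreover have "\<Union>((\<lambda>i. A i - {a}) ` K) = \<Union>(A ` K) - {a}" by auto
        ultimately show ?thesis
          using card_Diff_singleton_if[of "\<Union>(A ` K)" a] by (auto split: if_splits)
      qed simp
      ultimately obtain g where g: "inj_on g (I - {i})" "\<forall>j\<in>I - {i}. g j \<in> A j - {a}"
        using less.hyps[of "I - {i}" "\<lambda>i. A i - {a}"] fin finA by auto
      have "inj_on (g(i := a)) I"
        using g unfolding inj_on_def by auto
      moreover have "\<forall>j\<in>I. (g(i := a)) j \<in> A j" using g a by auto
      ultimately show ?thesis by blast
    qed
  qed
qed

text \<open>Without bipartiteness an odd cycle of \<open>f\<close> inside \<open>Z\<close> would be an obstruction.\<close>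

lemma matching_covering_if_injection:
  assumes "finite Z" "inj_on f Z" "\<And>z. z \<in> Z \<Longrightarrow> {z, f z} \<in> L" "\<And>z. z \<in> Z \<Longrightarrow> f z \<noteq> z"
    and "Z \<subseteq> A \<union> B"
    and "\<And>u v. u \<in> A \<Longrightarrow> v \<in> A \<Longrightarrow> {u, v} \<notin> L"
    and "\<And>u v. u \<in> B \<Longrightarrow> v \<in> B \<Longrightarrow> {u, v} \<notin> L"
  shows "\<exists>M. matching_of L M \<and> Z \<subseteq> \<Union>M \<and> \<Union>M \<subseteq> Z \<union> f ` Z"
  using assms(1-5)
proof (induction "card Z" arbitrary: Z rule: less_induct)
  case less
  note fin = less.prems(1) and inj = less.prems(2) and link = less.prems(3)
    and loop = less.prems(4) and bip = less.prems(5)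
  show ?case
  proof (cases "Z \<subseteq> f ` Z")
    case False
    then obtain z where z: "z \<in> Z" "z \<notin> f ` Z" by blast
    \<comment> \<open>Matching \<open>z\<close> with \<open>f z\<close> cannot collide with the
      rest: no other node is mapped to \<open>z\<close> or to \<open>f z\<close>. The upper bound on
      \<open>\<Union>M\<close> in the claim is there to carry this through the induction.\<close>
    let ?Z = "Z - {z, f z}"
    have "card ?Z < card Z" using z fin by (intro psubset_card_mono) auto
    moreover have "inj_on f ?Z" using inj by (rule inj_on_subset) auto
    ultimately have "\<exists>M. matching_of L M \<and> ?Z \<subseteq> \<Union>M \<and> \<Union>M \<subseteq> ?Z \<union> f ` ?Z"
      using fin bip by (intro less.hyps link loop) auto
    then obtain M where M: "matching_of L M" "?Z \<subseteq> \<Union>M" "\<Union>M \<subseteq> ?Z \<union> f ` ?Z"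
      by blast
    have "z \<notin> \<Union>M" "f z \<notin> \<Union>M" using M(3) z inj by (auto simp: inj_on_def)
    then have "matching_of L (insert {z, f z} M)"
      using M(1) link[OF z(1)] unfolding matching_of_def by auto
    then show ?thesis using M z by (intro exI[of _ "insert {z, f z} M"]) auto
  next
    case True
    \<comment> \<open>Now \<open>f\<close> permutes \<open>Z\<close> and exchanges the two
      independent sides, so its cycles are even and the links leaving one side form a perfect
      matching of \<open>Z\<close>.\<close>
    then have onto: "f ` Z = Z" using fin inj by (metis card_image card_subset_eq finite_imageI)
    let ?A = "Z \<inter> A" and ?B = "Z - A"
    have fA: "f ` ?A \<subseteq> ?B" using link onto assms(6) by blast
    have fB: "f ` ?B \<subseteq> ?A"
    proof
      fix y assume "y \<in> f ` ?B"
      then obtain x where x: "x \<in> Z" "x \<notin> A" "y = f x" by blast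
      then have "y \<notin> B" using link[OF x(1)] assms(7)[of x y] bip by auto
      then show "y \<in> ?A" using x onto bip by blast
    qed
    have "f ` ?A = ?B" using fA fB onto by blast
    moreover have "matching_of L ((\<lambda>a. {a, f a}) ` ?A)"
      using link inj fA unfolding matching_of_def inj_on_def by auto
    moreover have "\<Union>((\<lambda>a. {a, f a}) ` ?A) = ?A \<union> f ` ?A" by auto
    ultimately show ?thesis by (intro exI[of _ "(\<lambda>a. {a, f a}) ` ?A"]) auto
  qed
qed

lemma sum_incident_eq_sum_card:
  fixes q :: "'v set \<Rightarrow> nat"
  assumes "finite E" "finite X"
  shows "(\<Sum>i\<in>X. \<Sum>l\<in>{l\<in>E. i \<in> l}. q l) = (\<Sum>l\<in>E. q l * card (X \<inter> l))"
proof -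
  have "(\<Sum>i\<in>X. \<Sum>l\<in>{l\<in>E. i \<in> l}. q l) = (\<Sum>l\<in>E. \<Sum>i\<in>{i\<in>X. i \<in> l}. q l)"
    by (rule sum.swap_restrict[OF assms(2) assms(1)])
  also have "\<dots> = (\<Sum>l\<in>E. q l * card (X \<inter> l))"
    by (intro sum.cong) (auto simp: Int_def mult.commute)
  finally show ?thesis .
qed

text \<open>Hall's condition by counting link ends with multiplicity \<open>q\<close>: a set
  \<open>X\<close> of nodes of full degree carries \<open>card X * D\<close> of them, and its
  neighbourhood at least as many but at most \<open>D\<close> per node.\<close>

lemma matching_covering_max_degree:
  fixes q :: "'v set \<Rightarrow> nat"
  assumes G: "graph V E" and Z: "Z \<subseteq> V"
    and deg: "\<And>z. z \<in> Z \<Longrightarrow> (\<Sum>l\<in>{l\<in>E. z \<in> l}. q l) = D"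
    and max: "\<And>v. v \<in> V \<Longrightarrow> (\<Sum>l\<in>{l\<in>E. v \<in> l}. q l) \<le> D"
    and "D > 0" "Z \<subseteq> A \<union> B"
    and "\<And>u v. u \<in> A \<Longrightarrow> v \<in> A \<Longrightarrow> {u, v} \<notin> {l\<in>E. q l > 0}"
    and "\<And>u v. u \<in> B \<Longrightarrow> v \<in> B \<Longrightarrow> {u, v} \<notin> {l\<in>E. q l > 0}"
  shows "\<exists>M. matching_of {l\<in>E. q l > 0} M \<and> Z \<subseteq> \<Union>M"
proof -
  let ?L = "{l\<in>E. q l > 0}" and ?N = "\<lambda>z. {v\<in>V. {z, v} \<in> {l\<in>E. q l > 0}}"
  have finV: "finite V" and edge: "\<And>l. l \<in> E \<Longrightarrow> l \<subseteq> V \<and> card l = 2"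
    using G unfolding graph_def by auto
  have finE: "finite E" using edge finV by (meson PowI finite_Pow_iff finite_subset subsetI)
  have finZ: "finite Z" using Z finV finite_subset by blast
  have "\<exists>f. inj_on f Z \<and> (\<forall>z\<in>Z. f z \<in> ?N z)"
  proof (rule hall_marriage[OF finZ])
    show "finite (?N z)" for z using finV by simp
    fix X assume X: "X \<subseteq> Z"
    let ?Y = "\<Union>(?N ` X)"
    have finX: "finite X" using X finZ finite_subset by auto
    have finY: "finite ?Y" by (rule finite_subset[OF _ finV]) auto
    have "card X * D = (\<Sum>i\<in>X. \<Sum>l\<in>{l\<in>E. i \<in> l}. q l)" using deg X by (simp add: subset_iff)
    also have "\<dots> = (\<Sum>l\<in>E. q l * card (X \<inter> l))"
      by (rule sum_incident_eq_sum_card[OF finE finX])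
    also have "\<dots> \<le> (\<Sum>l\<in>E. q l * card (?Y \<inter> l))"
    proof (rule sum_mono)
      fix l assume l: "l \<in> E"
      obtain a b where ab: "l = {a, b}" "a \<noteq> b" using edge[OF l] by (auto simp: card_2_iff)
      \<comment> \<open>Each end of a link in \<open>X\<close> puts the opposite end in
        \<open>?Y\<close>; a link inside \<open>X\<close> counts twice on both sides.\<close>
      have "a \<in> X \<Longrightarrow> b \<in> ?Y" "b \<in> X \<Longrightarrow> a \<in> ?Y" if "q l > 0"
        using that l edge[OF l] ab(1) by (auto simp: insert_commute)
      then have "card (X \<inter> l) \<le> card (?Y \<inter> l)" if "q l > 0"
        using that unfolding ab(1) using ab(2) by (auto simp: Int_insert_right)
      then show "q l * card (X \<inter> l) \<le> q l * card (?Y \<inter> l)" by auto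
    qed
    also have "\<dots> = (\<Sum>i\<in>?Y. \<Sum>l\<in>{l\<in>E. i \<in> l}. q l)"
      by (rule sum_incident_eq_sum_card[OF finE finY, symmetric])
    also have "\<dots> \<le> card ?Y * D" using max sum_bounded_above[of ?Y _ D] by auto
    finally show "card X \<le> card ?Y" using \<open>D > 0\<close> by simp
  qed
  then obtain f where f: "inj_on f Z" "\<forall>z\<in>Z. f z \<in> ?N z" by blast
  then have "f z \<noteq> z" if "z \<in> Z" for z using that edge[of "{z, f z}"] by auto
  then show ?thesis
    using matching_covering_if_injection[of Z f ?L A B] finZ f assms(6-8) by auto
qed

text \<open>The alternating path of \<open>M\<close> and \<open>N\<close> starting at \<open>z\<close> is flipped one step at a time.\<close>

lemma matching_exchange:
  assumes "finite N" "matching_of L M" "matching_of L N" "\<And>l. l \<in> L \<Longrightarrow> card l = 2"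
    and "z \<in> \<Union>M" "z \<notin> \<Union>N"
  shows "\<exists>N'. matching_of L N' \<and>
    (insert z (\<Union>N) \<subseteq> \<Union>N' \<or> (\<exists>v\<in>\<Union>N - \<Union>M. \<Union>N' = insert z (\<Union>N) - {v}))"
  using assms
proof (induction "card (N - M)" arbitrary: N z rule: less_induct)
  case less
  note fin = less.prems(1) and M = less.prems(2) and N = less.prems(3) and c2 = less.prems(4)
    and z = less.prems(5-6)
  have partner: "\<exists>u. l = {x, u} \<and> u \<noteq> x" if "l \<in> L" "x \<in> l" for l x
    using c2[OF that(1)] that(2) by (auto simp: card_2_iff insert_commute)
  obtain e where e: "e \<in> M" "z \<in> e" using z by blast
  obtain u where u: "e = {z, u}" "u \<noteq> z"
    using partner[of e z] e M unfolding matching_of_def by blast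
  show ?case
  proof (cases "u \<in> \<Union>N")
    case False
    then have "matching_of L (insert e N)"
      using N M e u z unfolding matching_of_def by auto
    then show ?thesis using u by (intro exI[of _ "insert e N"]) auto
  next
    case True
    then obtain d where d: "d \<in> N" "u \<in> d" by blast
    obtain v where v: "d = {u, v}" "v \<noteq> u"
      using partner[of d u] d N unfolding matching_of_def by blast
    have "v \<noteq> z" using z d v by auto
    \<comment> \<open>Swapping \<open>d\<close> for \<open>e\<close> covers \<open>z\<close> and
      exposes only \<open>v\<close>. If \<open>M\<close> misses \<open>v\<close>, the path ends
      here; otherwise \<open>v\<close> takes over the role of \<open>z\<close>, and
      \<open>N - M\<close> has lost \<open>d\<close>.\<close>
    let ?N = "insert e (N - {d})"
    have disj: "\<Union>(N - {d}) \<inter> d = {}" using N d unfolding matching_of_def by auto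
    have mN: "matching_of L ?N"
      using N M e u z disj v unfolding matching_of_def by auto
    have VN: "\<Union>?N = insert z (\<Union>N) - {v}"
      using disj d v u \<open>v \<noteq> z\<close> by auto
    show ?thesis
    proof (cases "v \<in> \<Union>M")
      case False
      then show ?thesis using mN VN d v by (intro exI[of _ ?N]) auto
    next
      case True
      have "d \<notin> M" using M e u d v \<open>v \<noteq> z\<close> unfolding matching_of_def
        by (metis disjoint_iff insertCI insertE singletonD)
      then have "card (?N - M) < card (N - M)"
        using fin d e by (intro psubset_card_mono) auto
      moreover have "finite ?N" "v \<notin> \<Union>?N" using VN fin by auto
      ultimately have "\<exists>N'. matching_of L N' \<and>
          (insert v (\<Union>?N) \<subseteq> \<Union>N' \<or> (\<exists>w\<in>\<Union>?N - \<Union>M. \<Union>N' = insert v (\<Union>?N) - {w}))"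
        using M mN c2 True by (intro less.hyps)
      then obtain N' where N': "matching_of L N'"
        "insert v (\<Union>?N) \<subseteq> \<Union>N' \<or> (\<exists>w\<in>\<Union>?N - \<Union>M. \<Union>N' = insert v (\<Union>?N) - {w})"
        by (elim exE conjE)
      \<comment> \<open>Covering \<open>v\<close> again restores all of \<open>N\<close> together
        with \<open>z\<close>, so the induction result for \<open>v\<close> is already the claim for
        \<open>z\<close>.\<close>
      have *: "insert v (\<Union>?N) = insert z (\<Union>N)" using VN d v by auto
      have uncov: "\<Union>?N - \<Union>M \<subseteq> \<Union>N - \<Union>M" using VN z(1) by auto
      from N'(2) have "insert z (\<Union>N) \<subseteq> \<Union>N' \<or> (\<exists>w\<in>\<Union>N - \<Union>M. \<Union>N' = insert z (\<Union>N) - {w})"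
        using uncov unfolding * by (meson subsetD)
      then show ?thesis using N'(1) by blast
    qed
  qed
qed

text \<open>An uncovered \<open>z\<close> in \<open>Z\<close> could be exchanged in, either at no
  loss or at the cost of one node missed by \<open>M\<close>. As \<open>M\<close> covers
  \<open>Z\<close>, that node lies outside \<open>Z\<close> and is lighter, so the weight would grow
  in both cases.\<close>

lemma max_weight_matching_covers:
  fixes w :: "'v \<Rightarrow> real"
  assumes "finite V" "finite L" "\<And>l. l \<in> L \<Longrightarrow> l \<subseteq> V \<and> card l = 2"
    and "matching_of L N"
    and opt: "\<And>M. matching_of L M \<Longrightarrow> sum w {i\<in>V. i \<in> \<Union>M} \<le> sum w {i\<in>V. i \<in> \<Union>N}"
    and "matching_of L M" "Z \<subseteq> \<Union>M"
    and nonneg: "\<And>v. v \<in> V \<Longrightarrow> 0 \<le> w v"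
    and top: "\<And>z v. z \<in> Z \<Longrightarrow> v \<in> V - Z \<Longrightarrow> w v < w z"
    and pos: "\<And>z. z \<in> Z \<Longrightarrow> 0 < w z"
  shows "Z \<subseteq> \<Union>N"
proof
  fix z assume z: "z \<in> Z"
  have sub: "\<Union>K \<subseteq> V" if "matching_of L K" for K
    using that assms(3) unfolding matching_of_def by blast
  have eq: "{i\<in>V. i \<in> \<Union>K} = \<Union>K" if "matching_of L K" for K
    using sub[OF that] by auto
  have fin: "finite (\<Union>K)" if "matching_of L K" for K
    using sub[OF that] assms(1) finite_subset by blast
  have "finite N" using assms(2,4) finite_subset unfolding matching_of_def by blast
  show "z \<in> \<Union>N"
  proof (rule ccontr)
    assume nz: "z \<notin> \<Union>N"
    have ins: "sum w (insert z (\<Union>N)) = w z + sum w (\<Union>N)"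
      using nz fin[OF assms(4)] by simp
    have "z \<in> \<Union>M" using assms(7) z by blast
    then obtain N' where N': "matching_of L N'"
      "insert z (\<Union>N) \<subseteq> \<Union>N' \<or> (\<exists>v\<in>\<Union>N - \<Union>M. \<Union>N' = insert z (\<Union>N) - {v})"
      using matching_exchange[OF \<open>finite N\<close> assms(6,4) _ _ nz] assms(3) by auto
    have le: "sum w (\<Union>N') \<le> sum w (\<Union>N)"
      using opt[OF N'(1)] eq[OF N'(1)] eq[OF assms(4)] by simp
    from N'(2) show False
    proof
      assume "insert z (\<Union>N) \<subseteq> \<Union>N'"
      then have "sum w (insert z (\<Union>N)) \<le> sum w (\<Union>N')"
        using sub[OF N'(1)] nonneg by (intro sum_mono2 fin[OF N'(1)]) auto
      then show False using le ins pos[OF z] by linarith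
    next
      assume "\<exists>v\<in>\<Union>N - \<Union>M. \<Union>N' = insert z (\<Union>N) - {v}"
      then obtain v where v: "v \<in> \<Union>N" "v \<notin> \<Union>M" "\<Union>N' = insert z (\<Union>N) - {v}" by blast
      have "sum w (\<Union>N') = w z + sum w (\<Union>N) - w v"
        unfolding v(3) using v(1) fin[OF assms(4)] ins by (subst sum_diff1) auto
      moreover have "w v < w z" using v(1,2) assms(7) sub[OF assms(4)] top[OF z] by blast
      ultimately show False using le by linarith
    qed
  qed
qed

subsection \<open>Schedules\<close>

text \<open>Kept general for all feasible schedules, since the lower bound must also be applied to
  an optimal one.\<close>

locale single_hop =
  fixes V :: "'v set" and E :: "'v set set" and Q0 :: "'v set \<Rightarrow> nat" and S :: "nat \<Rightarrow> 'v set set"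
  assumes graph: "graph V E" and feasible: "feasible E Q0 S"
begin

abbreviation "Q \<equiv> node_queue E Q0 S"
abbreviation "D \<equiv> Delta V E Q0 S"
abbreviation "links k \<equiv> {l\<in>E. queue Q0 S k l > 0}"

lemma finite_V: "finite V" and edge: "l \<in> E \<Longrightarrow> l \<subseteq> V \<and> card l = 2" and finite_E: "finite E"
proof -
  show V: "finite V" using graph by (simp add: graph_def)
  show e: "l \<in> E \<Longrightarrow> l \<subseteq> V \<and> card l = 2" for l using graph by (simp add: graph_def)
  have "E \<subseteq> Pow V" using e by blast
  then show "finite E" using V by (meson finite_Pow_iff finite_subset)
qed

lemma edgeE:
  assumes "l \<in> E"
  obtains u v where "l = {u, v}" "u \<noteq> v" "u \<in> V" "v \<in> V"
proof -
  obtain u v where "l = {u, v}" "u \<noteq> v" using edge[OF assms] by (auto simp: card_2_iff)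
  then show thesis using that edge[OF assms] by blast
qed

lemma matching: "matching_of (links k) (S k)"
  using feasible by (simp add: feasible_def)

lemma scheduled_pos: "l \<in> S k \<Longrightarrow> l \<in> E \<and> queue Q0 S k l > 0"
  using matching[of k] by (auto simp: matching_of_def)

lemma links_Suc_subset: "links (Suc k) \<subseteq> links k"
  by auto

text \<open>A matching has at most one link at \<open>i\<close>. The additive form avoids truncated
  subtraction.\<close>

lemma Q_Suc: "Q k i = Q (Suc k) i + R S i k"
proof -
  have "queue Q0 S k l = queue Q0 S (Suc k) l + (if l \<in> S k then 1 else 0)" for l
    using scheduled_pos[of l k] by auto
  then have "Q k i = Q (Suc k) i + (\<Sum>l\<in>{l\<in>E. i \<in> l}. if l \<in> S k then 1 else 0)"
    unfolding node_queue_def by (subst sum.distrib[symmetric]) (rule sum.cong[OF refl])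
  also have "(\<Sum>l\<in>{l\<in>E. i \<in> l}. if l \<in> S k then 1 else 0) = card {l\<in>S k. i \<in> l}"
    using finite_E scheduled_pos
    by (subst sum.inter_filter[symmetric]) (auto intro!: arg_cong[where f = card])
  also have "\<dots> = R S i k"
  proof (cases "i \<in> \<Union>(S k)")
    case True
    then obtain l where "l \<in> S k" "i \<in> l" by blast
    then have "{l\<in>S k. i \<in> l} = {l}"
      using matching[of k] unfolding matching_of_def by blast
    then show ?thesis using True by (simp add: R_def)
  next
    case False
    then have "{l\<in>S k. i \<in> l} = {}" by blast
    then show ?thesis using False unfolding R_def by (simp only: card.empty if_False)
  qed
  finally show ?thesis .
qed

lemma Q_le_D: "i \<in> V \<Longrightarrow> Q k i \<le> D k"
  unfolding Delta_def by (simp add: finite_V)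

lemma D_leI: "V \<noteq> {} \<Longrightarrow> (\<And>i. i \<in> V \<Longrightarrow> Q k i \<le> c) \<Longrightarrow> D k \<le> c"
  unfolding Delta_def by (simp add: finite_V)

lemma D_attained: "V \<noteq> {} \<Longrightarrow> \<exists>i\<in>V. Q k i = D k"
  using Max_in[of "Q k ` V"] finite_V unfolding Delta_def by fastforce

lemma queue_le_Q: "l \<in> E \<Longrightarrow> i \<in> l \<Longrightarrow> queue Q0 S k l \<le> Q k i"
  unfolding node_queue_def by (rule member_le_sum) (auto simp: finite_E)

lemma evacuated_if_D_0: "D k = 0 \<Longrightarrow> evacuated E Q0 S k"
  unfolding evacuated_def
proof
  fix l assume "D k = 0" "l \<in> E"
  then obtain u v where "l = {u, v}" "u \<in> V" by (elim edgeE)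
  then show "queue Q0 S k l = 0"
    using \<open>D k = 0\<close> queue_le_Q[OF \<open>l \<in> E\<close>, of u k] Q_le_D[of u k] by simp
qed

lemma D_Suc: "V \<noteq> {} \<Longrightarrow> D (Suc k) \<le> D k"
proof (rule D_leI)
  fix i assume "i \<in> V"
  then show "Q (Suc k) i \<le> D k" using Q_Suc[of k i] Q_le_D[of i k] by simp
qed

text \<open>A node of maximum initial workload loses at most one packet per slot.\<close>

lemma D_le_evacuation:
  assumes "V \<noteq> {}" "evacuated E Q0 S T"
  shows "D 0 \<le> T"
proof -
  have *: "Q 0 i \<le> Q k i + k" for i k
  proof (induction k)
    case (Suc k)
    have "R S i k \<le> 1" by (simp add: R_def)
    then show ?case using Suc Q_Suc[of k i] by simp
  qed simp
  have "Q T i = 0" for i using assms(2) by (simp add: evacuated_def node_queue_def)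
  then show ?thesis using D_leI[OF assms(1), of 0 T] *[of _ T] by simp
qed

end

section \<open>NSB runs: maximality and service of critical nodes\<close>

locale nsb = single_hop +
  assumes optimal: "matching_of (links k) M \<Longrightarrow>
    matching_weight V E Q0 S k M \<le> matching_weight V E Q0 S k (S k)"
begin

lemma U_le_1: "U S i k \<le> 1"
  by (simp add: U_def R_def)

lemma weight_ge: "real (Q k i) \<le> nsb_weight V E Q0 S k i"
proof -
  have "real (Q k i) * 1 \<le> real (Q k i) * (2 - real (U S i k))"
    using U_le_1[of i k] by (intro mult_left_mono) auto
  then show ?thesis by (simp add: nsb_weight_def)
qed

lemma weight_le:
  "nsb_weight V E Q0 S k i \<le> (if U S i k = 0 then 2 * real (Q k i) else real (Q k i))"
  using U_le_1[of i k] by (cases "U S i k") (auto simp: nsb_weight_def)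

lemma heavy_if_max:
  assumes "Q k i = D k"
  shows "heavy V E Q0 S k i"
proof -
  have "(real (card V) - 1) / real (card V) \<le> 1" by (cases "card V = 0") auto
  from mult_right_mono[OF this, of "real (D k)"] show ?thesis
    using assms by (simp only: heavy_def mult_1 of_nat_0_le_iff)
qed

text \<open>Both ends of a nonempty link have positive weight, so a link disjoint from the schedule
  could be added with strict gain.\<close>

lemma link_meets_schedule:
  assumes l: "l \<in> links k"
  shows "l \<inter> \<Union>(S k) \<noteq> {}"
proof
  assume disj: "l \<inter> \<Union>(S k) = {}"
  let ?w = "nsb_weight V E Q0 S k"
  have sub: "\<Union>(S k) \<subseteq> V" using scheduled_pos edge by blast
  then have fin: "finite (\<Union>(S k))" using finite_V finite_subset by blast
  have "matching_of (links k) (insert l (S k))"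
    using matching[of k] l disj unfolding matching_of_def by auto
  note opt = optimal[OF this]
  have l': "l \<subseteq> V" "finite l" "l \<noteq> {}" using edge[of l] l card_ge_0_finite[of l] by auto
  have eq: "{i\<in>V. i \<in> \<Union>(S k)} = \<Union>(S k)" "{i\<in>V. i \<in> \<Union>(insert l (S k))} = l \<union> \<Union>(S k)"
    using sub l' by auto
  have "0 < ?w i" if "i \<in> l" for i
    using queue_le_Q[of l i k] l that weight_ge[of k i] by auto
  then have "0 < sum ?w l" using l' by (intro sum_pos) auto
  then show False
    using opt unfolding matching_weight_def eq
    by (simp add: sum.union_disjoint[OF l'(2) fin disj])
qed

lemma unscheduled_independent:
  assumes "u \<notin> \<Union>(S k)" "v \<notin> \<Union>(S k)"
  shows "{u, v} \<notin> links k"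
proof
  assume "{u, v} \<in> links k"
  from link_meets_schedule[OF this] show False using assms by simp
qed

lemma critical_scheduled:
  assumes "D k > 0" "Z = {i\<in>V. Q k i = D k \<and> U S i k = 0}" "Z \<subseteq> A \<union> B"
    and "\<And>u v. u \<in> A \<Longrightarrow> v \<in> A \<Longrightarrow> {u, v} \<notin> links k"
    and "\<And>u v. u \<in> B \<Longrightarrow> v \<in> B \<Longrightarrow> {u, v} \<notin> links k"
  shows "Z \<subseteq> \<Union>(S k)"
proof -
  let ?w = "nsb_weight V E Q0 S k"
  have wZ: "?w z = 2 * real (D k)" if "z \<in> Z" for z
    using that assms(2) heavy_if_max[of k z] by (simp add: nsb_weight_def)
  \<comment> \<open>Outside \<open>Z\<close>, either the workload is below \<open>D k\<close>, or
    \<open>U\<close> is 1 and the weight is at most \<open>D k\<close>.\<close>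
  have wV: "?w v < 2 * real (D k)" if "v \<in> V - Z" for v
    using that assms(1,2) weight_le[of k v] Q_le_D[of v k] by (auto split: if_splits)
  have "\<exists>M. matching_of (links k) M \<and> Z \<subseteq> \<Union>M"
    by (rule matching_covering_max_degree[OF graph _ _ _ assms(1,3,4,5)])
      (use assms(2) Q_le_D in \<open>auto simp: node_queue_def\<close>)
  then obtain M where M: "matching_of (links k) M" "Z \<subseteq> \<Union>M" by blast
  show ?thesis
  proof (rule max_weight_matching_covers[OF finite_V _ _ matching _ M])
    show "finite (links k)" using finite_E by simp
    show "sum ?w {i\<in>V. i \<in> \<Union>M'} \<le> sum ?w {i\<in>V. i \<in> \<Union>(S k)}"
      if "matching_of (links k) M'" for M'
      using optimal[OF that] by (simp add: matching_weight_def)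
    show "0 \<le> ?w v" for v using weight_ge[of k v] by linarith
    show "?w v < ?w z" if "z \<in> Z" "v \<in> V - Z" for z v using wZ wV that by simp
    show "0 < ?w z" if "z \<in> Z" for z using wZ[OF that] assms(1) by simp
  qed (use edge in auto)
qed

section \<open>Decrease of the maximum workload\<close>

lemma D_Suc_eq_0_if_D_le_1:
  assumes "V \<noteq> {}" "D k \<le> 1"
  shows "D (Suc k) = 0"
proof -
  have "Q (Suc k) i = 0" for i
    unfolding node_queue_def
  proof (rule sum.neutral, rule ballI, rule ccontr)
    fix l assume l: "l \<in> {l\<in>E. i \<in> l}" "queue Q0 S (Suc k) l \<noteq> 0"
    then have "l \<in> links k" by auto
    then obtain u where u: "u \<in> l" "u \<in> \<Union>(S k)" using link_meets_schedule[of l k] by blast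
    \<comment> \<open>The link still holds a packet although its end \<open>u\<close> was just
      served, so \<open>u\<close> had at least two packets before.\<close>
    have "Q (Suc k) u \<noteq> 0" using queue_le_Q[of l u "Suc k"] l u by auto
    then have "Q k u \<ge> 2" using Q_Suc[of k u] u by (simp add: R_def)
    moreover have "u \<in> V" using edge[of l] l u by auto
    ultimately show False using assms(2) Q_le_D[of u k] by simp
  qed
  then show ?thesis using D_leI[OF assms(1), of "Suc k" 0] by simp
qed

text \<open>The nodes missed in the first slot of a frame are independent, those missed in the second
  slot too, so the nodes served at most once before the third slot induce a bipartite graph.\<close>

lemma D_frame:
  assumes "V \<noteq> {}"
  shows "D (3 * Suc j) \<le> D (3 * j) - 2"
proof (cases "D (3 * j) \<ge> 2")
  case False
  then have "D (Suc (3 * j)) = 0" using D_Suc_eq_0_if_D_le_1[OF assms] by simp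
  then show ?thesis
    using D_Suc[OF assms, of "Suc (3 * j)"] D_Suc[OF assms, of "Suc (Suc (3 * j))"]
    by (simp add: numeral_3_eq_3)
next
  case True
  define k where "k = 3 * j"
  let ?N = "\<lambda>k. - \<Union>(S k)"
  have U1: "U S i (Suc k) = R S i k" for i
    unfolding U_def k_def by (simp add: mod_Suc)
  have U2: "U S i (Suc (Suc k)) = R S i (Suc k) * R S i k" for i
    unfolding U_def k_def by (simp add: mod_Suc)
  have N0: "{u, v} \<notin> links k" if "u \<in> ?N k" "v \<in> ?N k" for u v k
    using that unscheduled_independent by simp
  \<comment> \<open>The first slot alone need not lower \<open>D\<close>, but the first two together
    lower it by at least 1.\<close>
  have D2: "D (Suc (Suc k)) \<le> D k - 1"
  proof (rule ccontr)
    assume "\<not> D (Suc (Suc k)) \<le> D k - 1"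
    moreover obtain i where i: "i \<in> V" "Q (Suc (Suc k)) i = D (Suc (Suc k))"
      using D_attained[OF assms] by blast
    \<comment> \<open>A node still at \<open>D k\<close> after two slots was missed in both, which
      makes it critical in the second.\<close>
    ultimately have Qi: "Q (Suc k) i = D k" "D (Suc k) = D k" "R S i k = 0" "R S i (Suc k) = 0"
      using D_Suc[OF assms, of k] D_Suc[OF assms, of "Suc k"] Q_le_D[of i k]
        Q_le_D[of i "Suc k"] Q_Suc[of k i] Q_Suc[of "Suc k" i] by linarith+
    have "{i\<in>V. Q (Suc k) i = D (Suc k) \<and> U S i (Suc k) = 0} \<subseteq> \<Union>(S (Suc k))"
    \<comment> \<open>Critical nodes here were missed in slot \<open>k\<close>, so a single
      independent set already contains them.\<close>
    proof (rule critical_scheduled[OF _ refl, where A = "?N k" and B = "?N k"])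
      show "D (Suc k) > 0" using Qi True by (simp add: k_def)
      show "{i\<in>V. Q (Suc k) i = D (Suc k) \<and> U S i (Suc k) = 0} \<subseteq> ?N k \<union> ?N k"
        by (auto simp: U1 R_def)
    qed (use N0 links_Suc_subset in blast)+
    then show False using i Qi by (auto simp: U1 R_def split: if_splits)
  qed
  have "D (Suc (Suc (Suc k))) \<le> D k - 2"
  proof (rule ccontr)
    assume "\<not> D (Suc (Suc (Suc k))) \<le> D k - 2"
    moreover obtain i where i: "i \<in> V" "Q (Suc (Suc (Suc k))) i = D (Suc (Suc (Suc k)))"
      using D_attained[OF assms] by blast
    \<comment> \<open>By \<open>D2\<close>, a node that still has \<open>D k - 1\<close> packets
      after the frame had exactly that many before its last slot. It was thus missed in the last
      slot and served at most once before, so its product \<open>U\<close> is 0.\<close>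
    ultimately have Qi: "Q (Suc (Suc k)) i = D k - 1" "D (Suc (Suc k)) = D k - 1"
      "R S i (Suc (Suc k)) = 0" "R S i k + R S i (Suc k) \<le> 1"
      using D2 D_Suc[OF assms, of "Suc (Suc k)"] Q_le_D[of i k] True
        Q_le_D[of i "Suc (Suc k)"] Q_Suc[of k i] Q_Suc[of "Suc k" i] Q_Suc[of "Suc (Suc k)" i]
      unfolding k_def[symmetric] by linarith+
    let ?Z = "{i\<in>V. Q (Suc (Suc k)) i = D (Suc (Suc k)) \<and> U S i (Suc (Suc k)) = 0}"
    have "?Z \<subseteq> \<Union>(S (Suc (Suc k)))"
    \<comment> \<open>A zero product means a miss in slot \<open>k\<close> or \<open>Suc k\<close>.
      Nonempty links only disappear, so both sets of missed nodes are still independent.\<close>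
    proof (rule critical_scheduled[OF _ refl, where A = "?N k" and B = "?N (Suc k)"])
      show "D (Suc (Suc k)) > 0" using Qi True by (simp add: k_def)
      show "?Z \<subseteq> ?N k \<union> ?N (Suc k)" by (auto simp: U2 R_def)
    qed (use N0 links_Suc_subset in blast)+
    then show False using i Qi by (auto simp: U2 R_def split: if_splits)
  qed
  then show ?thesis by (simp add: k_def numeral_3_eq_3)
qed

lemma D_frames: "V \<noteq> {} \<Longrightarrow> D (3 * j) \<le> D 0 - 2 * j"
proof (induction j)
  case (Suc j)
  then show ?case using D_frame[of j] by simp
qed simp

text \<open>For odd \<open>D 0\<close> a last full frame would overshoot the bound; the remaining
  workload of at most 1 is cleared in one slot, giving \<open>2 * T = 3 * D 0 - 1\<close>.\<close>

lemma evacuated_by: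
  assumes "V \<noteq> {}"
  shows "\<exists>T. evacuated E Q0 S T \<and> 2 * T \<le> 3 * D 0"
proof (cases "even (D 0)")
  case True
  then have "D (3 * (D 0 div 2)) = 0" using D_frames[OF assms, of "D 0 div 2"] by simp
  then show ?thesis using evacuated_if_D_0 by (intro exI[of _ "3 * (D 0 div 2)"]) auto
next
  case False
  then have "D (3 * (D 0 div 2)) \<le> 1" using D_frames[OF assms, of "D 0 div 2"] by presburger
  then have "D (Suc (3 * (D 0 div 2))) = 0" by (rule D_Suc_eq_0_if_D_le_1[OF assms])
  then show ?thesis
    using evacuated_if_D_0 False by (intro exI[of _ "Suc (3 * (D 0 div 2))"]) presburger
qed

end

text \<open>The first conjunct ensures that the \<open>LEAST\<close> in \<open>evac_time\<close> is
  attained.\<close>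

theorem theorem1:
  fixes V :: "'v set" and E :: "'v set set" and Q0 :: "'v set \<Rightarrow> nat"
    and S :: "nat \<Rightarrow> 'v set set"
  assumes "graph V E"
    and "nsb_run V E Q0 S"
  shows "(\<exists>T. evacuated E Q0 S T) \<and>
         real (evac_time E Q0 S) \<le> 3 / 2 * real (min_evac_time E Q0)"
proof -
  interpret nsb V E Q0 S
  proof
    show "graph V E" by (rule assms(1))
    show "feasible E Q0 S" using assms(2) by (simp add: nsb_run_def feasible_def)
    show "matching_weight V E Q0 S k M \<le> matching_weight V E Q0 S k (S k)"
      if "matching_of {l\<in>E. queue Q0 S k l > 0} M" for k M
      using assms(2) that by (simp add: nsb_run_def)
  qed
  show ?thesis
  proof (cases "V = {}")
    case True
    \<comment> \<open>Without nodes there are no links; this case is separate because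
      \<open>Delta\<close> is then the \<open>Max\<close> of an empty set.\<close>
    then have "evacuated E Q0 S 0" using edge by (fastforce simp: evacuated_def)
    then show ?thesis by (auto simp: evac_time_def)
  next
    case False
    obtain T where T: "evacuated E Q0 S T" "2 * T \<le> 3 * D 0" using evacuated_by[OF False] by blast
    \<comment> \<open>The NSB run itself shows that the minimum is attained.\<close>
    have "\<exists>T S'. feasible E Q0 S' \<and> evacuated E Q0 S' T" using feasible T(1) by blast
    then have "\<exists>S'. feasible E Q0 S' \<and> evacuated E Q0 S' (min_evac_time E Q0)"
      unfolding min_evac_time_def by (rule LeastI_ex)
    then obtain S' where S': "feasible E Q0 S'" "evacuated E Q0 S' (min_evac_time E Q0)" by blast
    interpret opt: single_hop V E Q0 S' using graph S'(1) by unfold_locales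
    \<comment> \<open>The initial maximum depends only on \<open>Q0\<close>, so it links the two
      schedules.\<close>
    have "D 0 = Delta V E Q0 S' 0" by (simp add: Delta_def node_queue_def)
    then have "D 0 \<le> min_evac_time E Q0" using opt.D_le_evacuation[OF False S'(2)] by simp
    moreover have "evac_time E Q0 S \<le> T"
      unfolding evac_time_def using T(1) by (rule Least_le)
    ultimately have "2 * evac_time E Q0 S \<le> 3 * min_evac_time E Q0" using T(2) by linarith
    then have "2 * real (evac_time E Q0 S) \<le> 3 * real (min_evac_time E Q0)"
      by (metis of_nat_le_iff of_nat_mult of_nat_numeral)
    then show ?thesis using T(1) by auto
  qed
qed

end
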